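(* The poset $\mathcal{H}$ is a dcpo, and the lattice of Scott-open subsets of $\mathcal{H}$ is order-isomorphic to the lattice of Scott-open subsets of $\mathsf{Irr}(\mathcal{H})$ (equivalently, $\Gamma(\mathcal{H})\cong\Gamma(\mathsf{Irr}(\mathcal{H}))$).
   Context: Let $\mathbb{N}$ be the natural numbers and $\mathbb{N}^*$ the set of finite strings of natural numbers; $\varepsilon$ is the empty string, $n{:}s$ is the string obtained by putting $n$ in front of $s$, $ts$ is concatenation, and for a nonempty string $t$, $\min(t)$ is its least entry. On $\mathbb{N}\times\mathbb{N}^*$ define, for $m,m',n,n'\in\mathbb{N}$ and $s,t\in\mathbb{N}^*$: $(m,n{:}s)<_1(m,n'{:}s)$ if $n<n'$; $(m,ts)<_2(m,s)$ if $t\neq\varepsilon$; $(m,ts)<_3(m',s)$ if $t\ne\varepsilon$ and $\min(t)\le m'$. Let $<\;=\;<_1\cup<_2\cup<_3\cup(<_2;<_1)\cup(<_3;<_1)$, where $x\,(R;R')\,z$ means there is $y$ with $x\,R\,y$ and $y\,R'\,z$, and let $\le\;=\;<\cup=$. This is a partial order; $\mathcal{H}$ is the poset $(\mathbb{N}\times\mathbb{N}^*,\le)$. For a dcpo $D$, $\Gamma(D)$ is the lattice of Scott-closed sets under inclusion; a subset is irreducible if nonempty and whenever contained in a union of two Scott-closed sets it is contained in one of them; $\mathsf{Irr}(D)$ is the set of Scott-closed irreducible subsets of $D$ ordered by inclusion (itself a dcpo). *)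

theory Defs
  imports "HOL-Algebra.Order" "HOL-Analysis.Abstract_Topology"
begin

section \<open>Directed complete posets and the Scott topology\<close>

definition directed :: "('a, 'b) gorder_scheme \<Rightarrow> 'a set \<Rightarrow> bool" where
  "directed L A \<longleftrightarrow>
     A \<subseteq> carrier L \<and> A \<noteq> {} \<and> (\<forall>x\<in>A. \<forall>y\<in>A. \<exists>z\<in>A. x \<sqsubseteq>\<^bsub>L\<^esub> z \<and> y \<sqsubseteq>\<^bsub>L\<^esub> z)"

locale dcpo = partial_order +
  assumes directed_sup_exists: "directed L A \<Longrightarrow> \<exists>s. is_lub L s A"

definition scott_open :: "('a, 'b) gorder_scheme \<Rightarrow> 'a set \<Rightarrow> bool" where
  "scott_open L U \<longleftrightarrow>
     U \<subseteq> carrier L \<and>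
     (\<forall>x\<in>U. \<forall>y\<in>carrier L. x \<sqsubseteq>\<^bsub>L\<^esub> y \<longrightarrow> y \<in> U) \<and>
     (\<forall>A s. directed L A \<and> is_lub L s A \<and> s \<in> U \<longrightarrow> A \<inter> U \<noteq> {})"

definition scott_topology :: "('a, 'b) gorder_scheme \<Rightarrow> 'a topology" where
  "scott_topology L = topology (scott_open L)"

lemma istopology_scott_open: "istopology (scott_open L)"
  unfolding istopology_def
proof (intro conjI allI impI)
  fix U V assume U: "scott_open L U" and V: "scott_open L V"
  show "scott_open L (U \<inter> V)"
    unfolding scott_open_def
  proof (intro conjI allI impI)
    show "U \<inter> V \<subseteq> carrier L"
      using U by (auto simp: scott_open_def)
    show "\<forall>x\<in>U \<inter> V. \<forall>y\<in>carrier L. x \<sqsubseteq>\<^bsub>L\<^esub> y \<longrightarrow> y \<in> U \<inter> V"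
      using U V unfolding scott_open_def by (meson IntD1 IntD2 IntI)
  next
    fix A s assume "directed L A \<and> is_lub L s A \<and> s \<in> U \<inter> V"
    then have A: "directed L A" and s: "is_lub L s A" "s \<in> U" "s \<in> V" by simp_all
    have "A \<inter> U \<noteq> {}" "A \<inter> V \<noteq> {}"
      using U V A s unfolding scott_open_def by meson+
    then obtain x y where xy: "x \<in> A" "x \<in> U" "y \<in> A" "y \<in> V" by blast
    then obtain z where z: "z \<in> A" "x \<sqsubseteq>\<^bsub>L\<^esub> z" "y \<sqsubseteq>\<^bsub>L\<^esub> z"
      using A by (meson directed_def)
    moreover have "z \<in> carrier L"
      using A z(1) by (auto simp: directed_def)
    ultimately have "z \<in> U" "z \<in> V"
      using U V xy unfolding scott_open_def by meson+
    with z(1) show "A \<inter> (U \<inter> V) \<noteq> {}" by blast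
  qed
next
  fix K assume K: "\<forall>U\<in>K. scott_open L U"
  show "scott_open L (\<Union>K)"
    unfolding scott_open_def
  proof (intro conjI allI impI)
    show "\<Union>K \<subseteq> carrier L"
      using K by (auto simp: scott_open_def)
    show "\<forall>x\<in>\<Union>K. \<forall>y\<in>carrier L. x \<sqsubseteq>\<^bsub>L\<^esub> y \<longrightarrow> y \<in> \<Union>K"
      using K unfolding scott_open_def by (meson Union_iff)
  next
    fix A s assume A: "directed L A \<and> is_lub L s A \<and> s \<in> \<Union>K"
    then obtain U where U: "U \<in> K" "s \<in> U" by blast
    then have "A \<inter> U \<noteq> {}"
      using A K unfolding scott_open_def by meson
    with U(1) show "A \<inter> \<Union>K \<noteq> {}" by blast
  qed
qed

lemma openin_scott_topology: "openin (scott_topology L) U \<longleftrightarrow> scott_open L U"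
  by (simp add: scott_topology_def istopology_scott_open topology_inverse')

lemma topspace_scott_topology: "topspace (scott_topology L) = carrier L"
proof -
  have "scott_open L (carrier L)"
    by (auto simp: scott_open_def directed_def)
  then show ?thesis
    unfolding topspace_def openin_scott_topology by (auto simp: scott_open_def)
qed


section \<open>Lattices of open and closed sets, irreducible sets, order isomorphism\<close>

definition inclusion_order :: "'a set set \<Rightarrow> 'a set gorder" where
  "inclusion_order \<S> = \<lparr>carrier = \<S>, eq = (=), le = (\<subseteq>)\<rparr>"

definition scott_opens :: "('a, 'b) gorder_scheme \<Rightarrow> 'a set gorder" where
  "scott_opens L = inclusion_order {U. openin (scott_topology L) U}"

definition scott_closeds :: "('a, 'b) gorder_scheme \<Rightarrow> 'a set gorder" where
  "scott_closeds L = inclusion_order {C. closedin (scott_topology L) C}"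

definition irreducible_in :: "'a topology \<Rightarrow> 'a set \<Rightarrow> bool" where
  "irreducible_in X S \<longleftrightarrow>
     S \<subseteq> topspace X \<and> S \<noteq> {} \<and>
     (\<forall>C D. closedin X C \<and> closedin X D \<and> S \<subseteq> C \<union> D \<longrightarrow> S \<subseteq> C \<or> S \<subseteq> D)"

definition Irr :: "('a, 'b) gorder_scheme \<Rightarrow> 'a set gorder" where
  "Irr L = inclusion_order
     {S. closedin (scott_topology L) S \<and> irreducible_in (scott_topology L) S}"

definition order_isomorphic :: "('a, 'c) gorder_scheme \<Rightarrow> ('b, 'd) gorder_scheme \<Rightarrow> bool" where
  "order_isomorphic L M \<longleftrightarrow> (\<exists>f. order_emb L M f \<and> bij_betw f (carrier L) (carrier M))"


section \<open>The poset H\<close>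

inductive less1 :: "nat \<times> nat list \<Rightarrow> nat \<times> nat list \<Rightarrow> bool" where
  "n < n' \<Longrightarrow> less1 (m, n # s) (m, n' # s)"

inductive less2 :: "nat \<times> nat list \<Rightarrow> nat \<times> nat list \<Rightarrow> bool" where
  "t \<noteq> [] \<Longrightarrow> less2 (m, t @ s) (m, s)"

inductive less3 :: "nat \<times> nat list \<Rightarrow> nat \<times> nat list \<Rightarrow> bool" where
  "t \<noteq> [] \<Longrightarrow> Min (set t) \<le> m' \<Longrightarrow> less3 (m, t @ s) (m', s)"

text \<open>\<open>R OO R'\<close> is composition in diagrammatic order: first a step of \<open>R\<close>, then one of \<open>R'\<close>.\<close>

definition H_less :: "nat \<times> nat list \<Rightarrow> nat \<times> nat list \<Rightarrow> bool" where
  "H_less x y \<longleftrightarrow> less1 x y \<or> less2 x y \<or> less3 x y \<or> (less2 OO less1) x y \<or> (less3 OO less1) x y"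

definition H :: "(nat \<times> nat list) gorder" where
  "H = \<lparr>carrier = UNIV, eq = (=), le = (\<lambda>x y. H_less x y \<or> x = y)\<rparr>"

end

theory Submission
  imports Defs
begin

text \<open>The Scott-closed irreducible subsets of \<open>H\<close> are the principal ideals and, for every
  string \<open>s\<close>, the ideal \<open>level_closure s\<close> generated by the level \<open>{(m, s) | m}\<close>. A Scott-closed
  family in \<open>Irr H\<close> is nevertheless determined by its principal members: \<open>level_closure s\<close> is the
  directed supremum of the sets \<open>level_closure (n # s)\<close>, and \<open>level_closure (n # s)\<close> is contained in
  the principal ideal of \<open>(n, s)\<close>. So \<open>C \<mapsto> {S. S \<subseteq> C}\<close> is an isomorphism from the Scott-closed
  sets of \<open>H\<close> to those of \<open>Irr H\<close>, although \<open>Irr H\<close> has more points.\<close>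

section \<open>Scott-closed sets and irreducible sets\<close>

text \<open>Contraposition of the clauses of \<open>scott_open\<close>: directedness places
  \<open>A\<close>, and \<open>is_lub\<close> places \<open>s\<close>, in the carrier, so avoiding
  the complement of \<open>C\<close> is the same as lying in \<open>C\<close>.\<close>

lemma closedin_scott_iff:
  "closedin (scott_topology L) C \<longleftrightarrow>
     C \<subseteq> carrier L \<and>
     (\<forall>y\<in>C. \<forall>x\<in>carrier L. x \<sqsubseteq>\<^bsub>L\<^esub> y \<longrightarrow> x \<in> C) \<and>
     (\<forall>A s. directed L A \<and> is_lub L s A \<and> A \<subseteq> C \<longrightarrow> s \<in> C)"
proof -
  have lub: "(directed L A \<and> is_lub L s A \<and> s \<in> carrier L - C \<longrightarrow> A \<inter> (carrier L - C) \<noteq> {}) \<longleftrightarrow>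
      (directed L A \<and> is_lub L s A \<and> A \<subseteq> C \<longrightarrow> s \<in> C)" for A s
    by (auto simp: directed_def least_def Upper_def)
  have down: "(\<forall>x\<in>carrier L - C. \<forall>y\<in>carrier L. x \<sqsubseteq>\<^bsub>L\<^esub> y \<longrightarrow> y \<in> carrier L - C) \<longleftrightarrow>
      (\<forall>y\<in>C. \<forall>x\<in>carrier L. x \<sqsubseteq>\<^bsub>L\<^esub> y \<longrightarrow> x \<in> C)" if "C \<subseteq> carrier L"
    using that by blast
  show ?thesis
    unfolding closedin_def openin_scott_topology topspace_scott_topology scott_open_def lub
    using down by auto
qed

lemma scott_closed_down:
  "closedin (scott_topology L) C \<Longrightarrow> y \<in> C \<Longrightarrow> x \<in> carrier L \<Longrightarrow> x \<sqsubseteq>\<^bsub>L\<^esub> y \<Longrightarrow> x \<in> C"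
  by (simp add: closedin_scott_iff)

lemma scott_closed_lub:
  "closedin (scott_topology L) C \<Longrightarrow> directed L A \<Longrightarrow> is_lub L s A \<Longrightarrow> A \<subseteq> C \<Longrightarrow> s \<in> C"
  unfolding closedin_scott_iff by metis

lemma carrier_inclusion_order [simp]: "carrier (inclusion_order \<S>) = \<S>"
  by (simp add: inclusion_order_def)

lemma le_inclusion_order [simp]: "A \<sqsubseteq>\<^bsub>inclusion_order \<S>\<^esub> B \<longleftrightarrow> A \<subseteq> B"
  by (simp add: inclusion_order_def)

lemma partial_order_inclusion_order: "partial_order (inclusion_order \<S>)"
  by unfold_locales (auto simp: inclusion_order_def)

text \<open>The intersections with \<open>\<S>\<close> mirror \<open>Upper\<close>, which compares
  only with those members of the family that lie in the carrier.\<close>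

lemma is_lub_inclusion_order:
  "is_lub (inclusion_order \<S>) S \<A> \<longleftrightarrow>
     S \<in> \<S> \<and> (\<forall>A\<in>\<A> \<inter> \<S>. A \<subseteq> S) \<and> (\<forall>T\<in>\<S>. (\<forall>A\<in>\<A> \<inter> \<S>. A \<subseteq> T) \<longrightarrow> S \<subseteq> T)"
proof -
  have "Upper (inclusion_order \<S>) \<A> = {T \<in> \<S>. \<forall>A\<in>\<A> \<inter> \<S>. A \<subseteq> T}"
    by (auto simp: Upper_def)
  then show ?thesis unfolding least_def by auto
qed

lemma order_isomorphic_inclusion_order:
  assumes "bij_betw f \<S> \<T>" "\<And>A B. A \<in> \<S> \<Longrightarrow> B \<in> \<S> \<Longrightarrow> f A \<subseteq> f B \<longleftrightarrow> A \<subseteq> B"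
  shows "order_isomorphic (inclusion_order \<S>) (inclusion_order \<T>)"
proof -
  have "order_emb (inclusion_order \<S>) (inclusion_order \<T>) f"
    using assms(2) by (simp add: order_emb_def partial_order.axioms(1) partial_order_inclusion_order)
  with assms(1) show ?thesis
    unfolding order_isomorphic_def carrier_inclusion_order by blast
qed

text \<open>Conjugating with complementation on both sides reverses the order twice.\<close>

lemma order_isomorphic_opens_if_closeds:
  assumes "order_isomorphic (scott_closeds L) (scott_closeds M)"
  shows "order_isomorphic (scott_opens L) (scott_opens M)"
proof -
  let ?X = "scott_topology L" and ?Y = "scott_topology M"
  obtain f where "order_emb (scott_closeds L) (scott_closeds M) f"
    "bij_betw f (carrier (scott_closeds L)) (carrier (scott_closeds M))"
    using assms unfolding order_isomorphic_def by blast
  then have f: "bij_betw f {C. closedin ?X C} {C. closedin ?Y C}"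
    and emb: "\<And>A B. closedin ?X A \<Longrightarrow> closedin ?X B \<Longrightarrow> f A \<subseteq> f B \<longleftrightarrow> A \<subseteq> B"
    by (simp_all add: order_emb_def scott_closeds_def)
  have X: "bij_betw (\<lambda>U. topspace ?X - U) {U. openin ?X U} {C. closedin ?X C}"
    by (rule bij_betw_byWitness[where f' = "\<lambda>U. topspace ?X - U"])
      (auto simp: double_diff openin_subset closedin_subset)
  have Y: "bij_betw (\<lambda>U. topspace ?Y - U) {C. closedin ?Y C} {U. openin ?Y U}"
    by (rule bij_betw_byWitness[where f' = "\<lambda>U. topspace ?Y - U"])
      (auto simp: double_diff openin_subset closedin_subset)
  let ?g = "(\<lambda>U. topspace ?Y - U) \<circ> f \<circ> (\<lambda>U. topspace ?X - U)"
  show ?thesis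
    unfolding scott_opens_def
  proof (rule order_isomorphic_inclusion_order)
    show "bij_betw ?g {U. openin ?X U} {U. openin ?Y U}"
      using bij_betw_trans[OF bij_betw_trans[OF X f] Y] by (simp add: comp_assoc)
  next
    fix A B assume AB: "A \<in> {U. openin ?X U}" "B \<in> {U. openin ?X U}"
    let ?A = "topspace ?X - A" and ?B = "topspace ?X - B"
    have cl: "closedin ?X ?A" "closedin ?X ?B" using AB by auto
    then have "closedin ?Y (f ?A)" "closedin ?Y (f ?B)"
      using bij_betwE[OF f] by blast+
    then have "f ?A \<subseteq> topspace ?Y" "f ?B \<subseteq> topspace ?Y"
      by (auto dest: closedin_subset)
    then have "?g A \<subseteq> ?g B \<longleftrightarrow> f ?B \<subseteq> f ?A" by auto
    also have "\<dots> \<longleftrightarrow> ?B \<subseteq> ?A" using emb cl by blast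
    also have "\<dots> \<longleftrightarrow> A \<subseteq> B"
      using AB openin_subset by blast
    finally show "?g A \<subseteq> ?g B \<longleftrightarrow> A \<subseteq> B" .
  qed
qed

lemma carrier_Irr:
  "S \<in> carrier (Irr L) \<longleftrightarrow> closedin (scott_topology L) S \<and> irreducible_in (scott_topology L) S"
  by (simp add: Irr_def)

text \<open>If one member escaped \<open>C\<close> and another escaped \<open>D\<close>, a common
  upper bound in the family would escape both, against its irreducibility. This supplies upper
  bounds in \<open>Irr\<close> for directed families.\<close>

lemma irreducible_in_closure_Union:
  assumes "\<A> \<noteq> {}" "\<And>S. S \<in> \<A> \<Longrightarrow> irreducible_in X S"
    and dir: "\<And>S T. S \<in> \<A> \<Longrightarrow> T \<in> \<A> \<Longrightarrow> \<exists>R\<in>\<A>. S \<subseteq> R \<and> T \<subseteq> R"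
  shows "irreducible_in X (X closure_of \<Union>\<A>)"
  unfolding irreducible_in_def
proof (intro conjI allI impI)
  show "X closure_of \<Union>\<A> \<subseteq> topspace X" by (rule closure_of_subset_topspace)
  have sub: "\<Union>\<A> \<subseteq> X closure_of \<Union>\<A>"
    using assms(2) by (intro closure_of_subset) (auto simp: irreducible_in_def)
  then show "X closure_of \<Union>\<A> \<noteq> {}"
    using assms(1,2) unfolding irreducible_in_def by blast
  fix C D assume CD: "closedin X C \<and> closedin X D \<and> X closure_of \<Union>\<A> \<subseteq> C \<union> D"
  have "\<Union>\<A> \<subseteq> C \<or> \<Union>\<A> \<subseteq> D"
  proof (rule ccontr)
    assume "\<not> (\<Union>\<A> \<subseteq> C \<or> \<Union>\<A> \<subseteq> D)"
    then obtain S T where ST: "S \<in> \<A>" "\<not> S \<subseteq> C" "T \<in> \<A>" "\<not> T \<subseteq> D"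
      by (meson Sup_least)
    then obtain R where "R \<in> \<A>" "S \<subseteq> R" "T \<subseteq> R" using dir[OF ST(1,3)] by metis
    with ST have R: "R \<in> \<A>" "\<not> R \<subseteq> C" "\<not> R \<subseteq> D" by (meson subset_trans)+
    then have "R \<subseteq> C \<union> D" using sub CD by blast
    then show False using assms(2)[OF R(1)] R CD unfolding irreducible_in_def by metis
  qed
  then show "X closure_of \<Union>\<A> \<subseteq> C \<or> X closure_of \<Union>\<A> \<subseteq> D"
    using CD closure_of_minimal by metis
qed

section \<open>Principal ideals, and closed families of irreducible sets\<close>

definition down_set :: "('a, 'b) gorder_scheme \<Rightarrow> 'a \<Rightarrow> 'a set" where
  "down_set L x = {y \<in> carrier L. y \<sqsubseteq>\<^bsub>L\<^esub> x}"

context partial_order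
begin

lemma closedin_down_set: "x \<in> carrier L \<Longrightarrow> closedin (scott_topology L) (down_set L x)"
  unfolding closedin_scott_iff
proof (intro conjI allI impI)
  assume x: "x \<in> carrier L"
  then show "\<forall>y\<in>down_set L x. \<forall>z\<in>carrier L. z \<sqsubseteq> y \<longrightarrow> z \<in> down_set L x"
    unfolding down_set_def by (blast dest: le_trans)
  fix A s assume A: "directed L A \<and> is_lub L s A \<and> A \<subseteq> down_set L x"
  then have "x \<in> Upper L A" using x by (auto simp: down_set_def Upper_def)
  then show "s \<in> down_set L x" using A unfolding down_set_def least_def Upper_def by blast
qed (auto simp: down_set_def)

lemma down_set_subset_iff:
  assumes "x \<in> carrier L" "closedin (scott_topology L) C"
  shows "down_set L x \<subseteq> C \<longleftrightarrow> x \<in> C"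
  using assms scott_closed_down[OF assms(2)] by (auto simp: down_set_def)

text \<open>A closed set contains the ideal as soon as it contains the generator \<open>x\<close>,
  and \<open>x\<close> lies in one of the two closed sets of any cover.\<close>

lemma down_set_Irr:
  assumes "x \<in> carrier L" shows "down_set L x \<in> carrier (Irr L)"
proof -
  have "x \<in> down_set L x" using assms by (simp add: down_set_def)
  then have "irreducible_in (scott_topology L) (down_set L x)"
    using down_set_subset_iff[OF assms] closedin_subset[OF closedin_down_set[OF assms]]
    unfolding irreducible_in_def by auto
  then show ?thesis
    using assms by (simp add: carrier_Irr closedin_down_set)
qed

text \<open>Scott-closed families in \<open>Irr L\<close> are downsets, so the inverse map can only be
  \<open>\<C> \<mapsto> {x. down_set L x \<in> \<C>}\<close>; the hypothesis says exactly that nothing is lost by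
  recording only the principal members of \<open>\<C>\<close>.\<close>

lemma order_isomorphic_scott_closeds_Irr:
  assumes principal: "\<And>\<C> S. closedin (scott_topology (Irr L)) \<C> \<Longrightarrow> S \<in> carrier (Irr L) \<Longrightarrow>
    (\<And>x. x \<in> S \<Longrightarrow> down_set L x \<in> \<C>) \<Longrightarrow> S \<in> \<C>"
  shows "order_isomorphic (scott_closeds L) (scott_closeds (Irr L))"
proof -
  let ?X = "scott_topology L" and ?Y = "scott_topology (Irr L)"
  define \<Phi> where "\<Phi> C = {S \<in> carrier (Irr L). S \<subseteq> C}" for C
  define \<Psi> where "\<Psi> \<C> = {x \<in> carrier L. down_set L x \<in> \<C>}" for \<C>
  have Irr_le: "S \<sqsubseteq>\<^bsub>Irr L\<^esub> T \<longleftrightarrow> S \<subseteq> T" for S T by (simp add: Irr_def)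
  have \<Phi>: "closedin ?Y (\<Phi> C)" if C: "closedin ?X C" for C
    unfolding closedin_scott_iff
  proof (intro conjI allI impI)
    show "\<Phi> C \<subseteq> carrier (Irr L)" by (auto simp: \<Phi>_def)
    show "\<forall>T\<in>\<Phi> C. \<forall>S\<in>carrier (Irr L). S \<sqsubseteq>\<^bsub>Irr L\<^esub> T \<longrightarrow> S \<in> \<Phi> C"
      by (auto simp: \<Phi>_def Irr_le)
    fix \<A> S assume A: "directed (Irr L) \<A> \<and> is_lub (Irr L) S \<A> \<and> \<A> \<subseteq> \<Phi> C"
    \<comment> \<open>\<open>?T\<close> is an upper bound of \<open>\<A>\<close> inside
      \<open>Irr L\<close> and is contained in \<open>C\<close>; the supremum \<open>S\<close> lies
      below it.\<close>
    let ?T = "?X closure_of \<Union>\<A>"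
    have Airr: "\<And>S. S \<in> \<A> \<Longrightarrow> irreducible_in ?X S"
      using A by (auto simp: directed_def carrier_Irr)
    have "irreducible_in ?X ?T"
      by (rule irreducible_in_closure_Union[OF _ Airr])
        (use A in \<open>auto simp: directed_def Irr_le\<close>)
    then have "?T \<in> carrier (Irr L)" by (simp add: carrier_Irr)
    moreover have "\<forall>A\<in>\<A>. A \<subseteq> ?T"
      using Airr by (metis Sup_le_iff closure_of_subset irreducible_in_def)
    ultimately have "S \<subseteq> ?T"
      using A unfolding Irr_def is_lub_inclusion_order by auto
    also have "?T \<subseteq> C"
      using A C by (intro closure_of_minimal) (auto simp: \<Phi>_def)
    finally show "S \<in> \<Phi> C"
      using A unfolding \<Phi>_def Irr_def is_lub_inclusion_order by auto
  qed
  have \<Psi>: "closedin ?X (\<Psi> \<C>)" if C: "closedin ?Y \<C>" for \<C>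
    unfolding closedin_scott_iff
  proof (intro conjI allI impI)
    show "\<Psi> \<C> \<subseteq> carrier L" by (auto simp: \<Psi>_def)
    have mono: "down_set L x \<subseteq> down_set L y" if "x \<in> carrier L" "y \<in> carrier L" "x \<sqsubseteq> y" for x y
      using that unfolding down_set_def by (blast dest: le_trans)
    show "\<forall>y\<in>\<Psi> \<C>. \<forall>x\<in>carrier L. x \<sqsubseteq> y \<longrightarrow> x \<in> \<Psi> \<C>"
      using scott_closed_down[OF C] mono down_set_Irr by (auto simp: \<Psi>_def Irr_le)
    fix A s assume A: "directed L A \<and> is_lub L s A \<and> A \<subseteq> \<Psi> \<C>"
    have s: "s \<in> carrier L" "\<And>x. x \<in> A \<Longrightarrow> x \<sqsubseteq> s" and sub: "A \<subseteq> carrier L"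
      using A by (auto simp: least_def Upper_def directed_def)
    have dir: "directed (Irr L) (down_set L ` A)"
      unfolding directed_def
    proof (intro conjI ballI)
      show "down_set L ` A \<subseteq> carrier (Irr L)" using sub down_set_Irr by blast
      show "down_set L ` A \<noteq> {}" using A by (simp add: directed_def)
      fix S T assume "S \<in> down_set L ` A" "T \<in> down_set L ` A"
      then obtain x y where xy: "x \<in> A" "y \<in> A" "S = down_set L x" "T = down_set L y" by blast
      then obtain z where "z \<in> A" "x \<sqsubseteq> z" "y \<sqsubseteq> z" using A unfolding directed_def by blast
      then show "\<exists>R\<in>down_set L ` A. S \<sqsubseteq>\<^bsub>Irr L\<^esub> R \<and> T \<sqsubseteq>\<^bsub>Irr L\<^esub> R"
        using xy sub mono[of x z] mono[of y z] unfolding Irr_le by blast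
    qed
    \<comment> \<open>Principal ideals preserve directed suprema: an upper bound \<open>T\<close> in
      \<open>Irr L\<close> is Scott-closed and contains \<open>A\<close>, hence contains
      \<open>s\<close>.\<close>
    have "is_lub (Irr L) (down_set L s) (down_set L ` A)"
      unfolding Irr_def is_lub_inclusion_order
    proof (intro conjI ballI impI)
      show "down_set L s \<in> {S. closedin ?X S \<and> irreducible_in ?X S}"
        using down_set_Irr[OF s(1)] by (simp add: carrier_Irr)
    next
      fix S assume "S \<in> down_set L ` A \<inter> {S. closedin ?X S \<and> irreducible_in ?X S}"
      then show "S \<subseteq> down_set L s" using s sub mono by blast
    next
      fix T assume T: "T \<in> {S. closedin ?X S \<and> irreducible_in ?X S}"
        "\<forall>S\<in>down_set L ` A \<inter> {S. closedin ?X S \<and> irreducible_in ?X S}. S \<subseteq> T"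
      have "A \<subseteq> T"
      proof
        fix x assume x: "x \<in> A"
        then have "down_set L x \<subseteq> T"
          using T(2) down_set_Irr[of x] sub unfolding carrier_Irr by blast
        then show "x \<in> T" using T(1) x sub down_set_subset_iff by blast
      qed
      moreover have "closedin ?X T" "directed L A" "is_lub L s A" using T(1) A by simp_all
      ultimately have "s \<in> T" using scott_closed_lub by metis
      then show "down_set L s \<subseteq> T" using T(1) s(1) down_set_subset_iff by blast
    qed
    moreover have "down_set L ` A \<subseteq> \<C>" using A by (auto simp: \<Psi>_def)
    ultimately have "down_set L s \<in> \<C>"
      using scott_closed_lub[OF C dir] by blast
    then show "s \<in> \<Psi> \<C>" using s by (simp add: \<Psi>_def)
  qed
  have \<Psi>\<Phi>: "\<Psi> (\<Phi> C) = C" if "closedin ?X C" for C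
  proof -
    have "C \<subseteq> carrier L" using closedin_subset[OF that] by (simp add: topspace_scott_topology)
    then show ?thesis
      using down_set_Irr down_set_subset_iff[OF _ that] unfolding \<Psi>_def \<Phi>_def by blast
  qed
  have \<Phi>\<Psi>: "\<Phi> (\<Psi> \<C>) = \<C>" if C: "closedin ?Y \<C>" for \<C>
  proof (intro equalityI subsetI)
    fix S assume "S \<in> \<Phi> (\<Psi> \<C>)"
    \<comment> \<open>Here alone \<open>principal\<close> enters; the converse inclusion holds
      because \<open>\<C>\<close> is a downset.\<close>
    then show "S \<in> \<C>" using principal[OF C] by (auto simp: \<Phi>_def \<Psi>_def)
  next
    fix S assume S: "S \<in> \<C>"
    then have SI: "S \<in> carrier (Irr L)" using C by (auto simp: closedin_scott_iff)
    then have cl: "closedin ?X S" "S \<subseteq> carrier L"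
      using carrier_Irr closedin_subset topspace_scott_topology by metis+
    have "down_set L x \<in> \<C>" if "x \<in> S" for x
      using scott_closed_down[OF C S, of "down_set L x"] that cl down_set_Irr[of x]
        down_set_subset_iff[of x S] by (auto simp: Irr_le)
    then show "S \<in> \<Phi> (\<Psi> \<C>)" using SI cl by (auto simp: \<Phi>_def \<Psi>_def)
  qed
  show ?thesis
    unfolding scott_closeds_def
  proof (rule order_isomorphic_inclusion_order)
    show "bij_betw \<Phi> {C. closedin ?X C} {C. closedin ?Y C}"
      by (rule bij_betw_byWitness[where f' = \<Psi>]) (use \<Phi> \<Psi> \<Phi>\<Psi> \<Psi>\<Phi> in auto)
    show "\<Phi> A \<subseteq> \<Phi> B \<longleftrightarrow> A \<subseteq> B" if "A \<in> {C. closedin ?X C}" "B \<in> {C. closedin ?X C}" for A B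
    proof
      assume "\<Phi> A \<subseteq> \<Phi> B"
      then have "\<Psi> (\<Phi> A) \<subseteq> \<Psi> (\<Phi> B)" by (auto simp: \<Psi>_def)
      then show "A \<subseteq> B" using \<Psi>\<Phi> that by simp
    qed (auto simp: \<Phi>_def)
  qed
qed

end

section \<open>The order on H\<close>

text \<open>The reflexive closure of \<open>less1\<close>, read on strings alone since
  \<open>less1\<close> fixes the first coordinate.\<close>

definition head_le :: "nat list \<Rightarrow> nat list \<Rightarrow> bool" where
  "head_le u v \<longleftrightarrow> u = v \<or> (\<exists>n n' w. u = n # w \<and> v = n' # w \<and> n \<le> n')"

lemma carrier_H [simp]: "carrier H = UNIV"
  by (simp add: H_def)

text \<open>A normal form for equality and the five clauses of \<open>H_less\<close>: remove a
  prefix \<open>t\<close>, then raise the head of what is left. Asking for some entry of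
  \<open>t\<close> below \<open>m'\<close> instead of using \<open>Min\<close> makes the empty
  prefix force \<open>m = m'\<close>.\<close>

lemma H_le_iff:
  "(m, s) \<sqsubseteq>\<^bsub>H\<^esub> (m', v) \<longleftrightarrow>
     (\<exists>t u. s = t @ u \<and> head_le u v \<and> (m = m' \<or> (\<exists>n\<in>set t. n \<le> m')))"
  (is "_ \<longleftrightarrow> ?R")
proof
  have mem: "\<exists>n\<in>set t. n \<le> m" if "t \<noteq> []" "Min (set t) \<le> m" for t :: "nat list" and m
    using that by (metis List.finite_set Min_in set_empty)
  assume "(m, s) \<sqsubseteq>\<^bsub>H\<^esub> (m', v)"
  then consider "(m, s) = (m', v)" | "H_less (m, s) (m', v)" by (auto simp: H_def)
  then show ?R
  proof cases
    case 2
    then show ?thesis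
      unfolding H_less_def head_le_def
      by (fastforce elim!: less1.cases less2.cases less3.cases dest: mem intro: less_imp_le)
  qed (auto simp: head_le_def)
next
  assume ?R
  then obtain t u where tu: "s = t @ u" "head_le u v" "m = m' \<or> (\<exists>n\<in>set t. n \<le> m')" by blast
  have 23: "less2 (m, s) (m', u) \<or> less3 (m, s) (m', u)" if "t \<noteq> []"
  proof (cases "m = m'")
    case False
    then have "Min (set t) \<le> m'" using tu by (meson List.finite_set Min_le le_trans)
    then show ?thesis using tu that less3.intros by blast
  qed (use tu that less2.intros in blast)
  have 1: "less1 (m', u) (m', v)" if "u \<noteq> v"
    using tu(2) that by (auto simp: head_le_def intro!: less1.intros)
  show "(m, s) \<sqsubseteq>\<^bsub>H\<^esub> (m', v)"
  proof (cases "t = []")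
    case True
    then show ?thesis using tu 1 by (auto simp: H_def H_less_def)
  next
    case False
    then show ?thesis using 23 1 by (cases "u = v") (auto simp: H_def H_less_def)
  qed
qed

lemma head_le_refl [simp]: "head_le u u"
  by (simp add: head_le_def)

lemma head_le_length: "head_le u v \<Longrightarrow> length u = length v"
  by (auto simp: head_le_def)

lemma head_le_trans: "head_le u v \<Longrightarrow> head_le v w \<Longrightarrow> head_le u w"
  by (auto simp: head_le_def)

lemma head_le_Cons: "head_le (n # u) v \<longleftrightarrow> (\<exists>n'\<ge>n. v = n' # u)"
  by (auto simp: head_le_def)

lemma H_refl [simp]: "x \<sqsubseteq>\<^bsub>H\<^esub> x"
  by (simp add: H_def)

lemma H_le_head: "head_le u v \<Longrightarrow> (m, u) \<sqsubseteq>\<^bsub>H\<^esub> (m, v)"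
  unfolding H_le_iff by auto

lemma H_le_Cons_Cons: "i \<le> j \<Longrightarrow> (m, i # s) \<sqsubseteq>\<^bsub>H\<^esub> (m, j # s)"
  by (simp add: H_le_head head_le_Cons)

lemma H_trans:
  assumes "x \<sqsubseteq>\<^bsub>H\<^esub> y" "y \<sqsubseteq>\<^bsub>H\<^esub> z" shows "x \<sqsubseteq>\<^bsub>H\<^esub> z"
proof -
  obtain m s m' v m'' w where xyz: "x = (m, s)" "y = (m', v)" "z = (m'', w)"
    by (metis surj_pair)
  from assms obtain t u t' u' where
    1: "s = t @ u" "head_le u v" "m = m' \<or> (\<exists>n\<in>set t. n \<le> m')" and
    2: "v = t' @ u'" "head_le u' w" "m' = m'' \<or> (\<exists>n\<in>set t'. n \<le> m'')"
    unfolding xyz H_le_iff by blast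
  show ?thesis
  \<comment> \<open>If the second step removes a nonempty prefix, the head raised by the first step
    disappears with it. The prefixes then merge, with \<open>k'\<close> in place of
    \<open>k\<close>; as \<open>k' \<le> k\<close>, a witness \<open>k \<le> m''\<close>
    survives.\<close>
  proof (cases t')
    case Nil
    then have "s = t @ u \<and> head_le u w \<and> (m = m'' \<or> (\<exists>n\<in>set t. n \<le> m''))"
      using 1 2 head_le_trans by auto
    then show ?thesis unfolding xyz H_le_iff by blast
  next
    case (Cons k t'')
    then obtain k' where k': "u = k' # t'' @ u'" "k' \<le> k"
      using 1 2 by (auto simp: head_le_def)
    have "s = (t @ k' # t'') @ u' \<and> head_le u' w \<and>
        (m = m'' \<or> (\<exists>n\<in>set (t @ k' # t''). n \<le> m''))"
      using 1 2 k' Cons by auto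
    then show ?thesis unfolding xyz H_le_iff by blast
  qed
qed

text \<open>Going up never lengthens the string, so neither comparison removes a prefix and only the
  heads remain to be compared.\<close>

lemma H_antisym: "x \<sqsubseteq>\<^bsub>H\<^esub> y \<Longrightarrow> y \<sqsubseteq>\<^bsub>H\<^esub> x \<Longrightarrow> x = y"
proof -
  assume a: "x \<sqsubseteq>\<^bsub>H\<^esub> y" "y \<sqsubseteq>\<^bsub>H\<^esub> x"
  obtain m s m' v where xy: "x = (m, s)" "y = (m', v)" by (metis surj_pair)
  from a obtain t u t' u' where
    1: "s = t @ u" "head_le u v" "m = m' \<or> (\<exists>n\<in>set t. n \<le> m')" and
    2: "v = t' @ u'" "head_le u' s" "m' = m \<or> (\<exists>n\<in>set t'. n \<le> m)"
    unfolding xy H_le_iff by blast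
  have "t = []" "t' = []" using 1 2 by (auto dest!: head_le_length)
  then show ?thesis using 1 2 xy by (auto simp: head_le_def)
qed

lemma partial_order_H: "partial_order H"
proof -
  have "eq H = (=)" by (simp add: H_def)
  then show ?thesis
    by unfold_locales (simp_all add: H_antisym, (metis H_trans)+)
qed

text \<open>Going up in \<open>A\<close> from a member with shortest string can change nothing but the head of
  that string.\<close>

lemma directed_H_cases:
  assumes A: "directed H A"
  obtains (max) x where "x \<in> A" "\<And>y. y \<in> A \<Longrightarrow> y \<sqsubseteq>\<^bsub>H\<^esub> x"
    | (chain) m s where "\<And>y. y \<in> A \<Longrightarrow> \<exists>n. y \<sqsubseteq>\<^bsub>H\<^esub> (m, n # s)"
        "\<And>k. \<exists>n\<ge>k. (m, n # s) \<in> A"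
proof -
  obtain x0 where "x0 \<in> A" using A by (auto simp: directed_def)
  then obtain x where x: "x \<in> A" "\<And>y. y \<in> A \<Longrightarrow> length (snd x) \<le> length (snd y)"
    using ex_has_least_nat[of "\<lambda>x. x \<in> A" x0 "\<lambda>x. length (snd x)"]
    by blast
  obtain m v where mv: "x = (m, v)" by fastforce
  have above: "\<exists>w. head_le v w \<and> (m, w) \<in> A \<and> y \<sqsubseteq>\<^bsub>H\<^esub> (m, w)" if "y \<in> A" for y
  proof -
    obtain m' w where z: "(m', w) \<in> A" "(m, v) \<sqsubseteq>\<^bsub>H\<^esub> (m', w)" "y \<sqsubseteq>\<^bsub>H\<^esub> (m', w)"
      using A x(1) \<open>y \<in> A\<close> unfolding directed_def mv by (metis surj_pair)
    then obtain t u where tu: "v = t @ u" "head_le u w" "m = m' \<or> (\<exists>n\<in>set t. n \<le> m')"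
      unfolding H_le_iff by blast
    have "length v \<le> length w" using x(2)[OF z(1)] mv by simp
    then have "t = []" using tu(1) head_le_length[OF tu(2)] by simp
    then show ?thesis using z tu by auto
  qed
  show ?thesis
  proof (cases "\<exists>x\<in>A. \<forall>y\<in>A. y \<sqsubseteq>\<^bsub>H\<^esub> x")
    case True
    then show ?thesis using max by blast
  next
    case False
    \<comment> \<open>With \<open>v\<close> empty, \<open>above\<close> would make \<open>x\<close>
      a greatest element of \<open>A\<close>; hence \<open>v\<close> has a head.\<close>
    then obtain k0 s where v: "v = k0 # s"
      using above x(1) mv unfolding head_le_def by (metis list.exhaust)
    have up: "\<exists>n. (m, n # s) \<in> A \<and> y \<sqsubseteq>\<^bsub>H\<^esub> (m, n # s)" if "y \<in> A" for y
      using above[OF that] unfolding v head_le_Cons by blast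
    have "\<exists>n\<ge>k. (m, n # s) \<in> A" for k
    proof (rule ccontr)
      assume *: "\<not> (\<exists>n\<ge>k. (m, n # s) \<in> A)"
      \<comment> \<open>Were these heads bounded, the largest one would give a greatest element of
        \<open>A\<close>.\<close>
      define N where "N = {n. (m, n # s) \<in> A}"
      have "N \<subseteq> {..<k}" using * by (auto simp: N_def not_le[symmetric])
      then have fin: "finite N" using finite_subset by blast
      have ne: "k0 \<in> N" using x mv v by (simp add: N_def)
      have "y \<sqsubseteq>\<^bsub>H\<^esub> (m, Max N # s)" if "y \<in> A" for y
      proof -
        obtain n where n: "n \<in> N" "y \<sqsubseteq>\<^bsub>H\<^esub> (m, n # s)"
          using up[OF \<open>y \<in> A\<close>] unfolding N_def by blast
        have "(m, n # s) \<sqsubseteq>\<^bsub>H\<^esub> (m, Max N # s)"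
          using Max_ge[OF fin n(1)] by (rule H_le_Cons_Cons)
        then show ?thesis using n H_trans by blast
      qed
      moreover have "(m, Max N # s) \<in> A" using Max_in[OF fin] ne by (auto simp: N_def)
      ultimately show False using False by blast
    qed
    then show ?thesis using chain up by blast
  qed
qed

lemma H_le_Cons [simp]: "(m, n # s) \<sqsubseteq>\<^bsub>H\<^esub> (m, s)"
  unfolding H_le_iff by (rule exI[of _ "[n]"]) auto

text \<open>Given an upper bound \<open>(m', v)\<close>, take a point of the chain whose head
  \<open>n\<close> exceeds \<open>m'\<close> and all entries of \<open>v\<close>. Such an
  \<open>n\<close> must belong to the removed prefix, yet cannot witness \<open>n \<le> m'\<close>,
  so the comparison persists after deleting it.\<close>

lemma is_lub_H_chain:
  assumes "\<And>y. y \<in> A \<Longrightarrow> \<exists>n. y \<sqsubseteq>\<^bsub>H\<^esub> (m, n # s)" "\<And>k. \<exists>n\<ge>k. (m, n # s) \<in> A"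
  shows "is_lub H (m, s) A"
  unfolding least_def Upper_def
proof (intro conjI ballI; clarsimp?)
  show "(a, b) \<sqsubseteq>\<^bsub>H\<^esub> (m, s)" if "(a, b) \<in> A" for a b
    using assms(1)[OF that] H_trans H_le_Cons by blast
next
  fix m' v assume ub: "\<forall>a b. (a, b) \<in> A \<longrightarrow> (a, b) \<sqsubseteq>\<^bsub>H\<^esub> (m', v)"
  define k where "k = Suc (m' + sum_list v)"
  obtain n where n: "k \<le> n" "(m, n # s) \<sqsubseteq>\<^bsub>H\<^esub> (m', v)" using assms(2)[of k] ub by blast
  then obtain t u where tu: "n # s = t @ u" "head_le u v" "m = m' \<or> (\<exists>n\<in>set t. n \<le> m')"
    unfolding H_le_iff by blast
  have "t \<noteq> []"
  proof
    assume "t = []"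
    then obtain n' where "n \<le> n'" "v = n' # s" using tu by (auto simp: head_le_Cons)
    then show False using n by (simp add: k_def)
  qed
  then obtain t' where t': "t = n # t'" "s = t' @ u" using tu by (cases t) auto
  then have "m = m' \<or> (\<exists>n\<in>set t'. n \<le> m')" using tu(3) n(1) by (auto simp: k_def)
  then show "(m, s) \<sqsubseteq>\<^bsub>H\<^esub> (m', v)" using t' tu unfolding H_le_iff by blast
qed

lemma dcpo_H: "dcpo H"
proof -
  interpret partial_order H by (rule partial_order_H)
  show ?thesis
  proof
    fix A :: "(nat \<times> nat list) set"
    assume "directed H A"
    then show "\<exists>s. is_lub H s A"
    proof (cases rule: directed_H_cases)
      case (max x)
      then have "is_lub H x A" unfolding least_def Upper_def carrier_H by blast
      then show ?thesis ..
    next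
      case (chain m s)
      then show ?thesis using is_lub_H_chain by blast
    qed
  qed
qed

section \<open>The Scott-closed irreducible subsets of H\<close>

text \<open>By \<open>directed_H_cases\<close>, a directed set without a greatest element has the
  supremum of a chain \<open>(m, n # s)\<close>, so only these suprema need testing.\<close>

lemma closedin_H_iff:
  "closedin (scott_topology H) C \<longleftrightarrow>
     (\<forall>x y. y \<in> C \<longrightarrow> x \<sqsubseteq>\<^bsub>H\<^esub> y \<longrightarrow> x \<in> C) \<and>
     (\<forall>m s. (\<forall>n. (m, n # s) \<in> C) \<longrightarrow> (m, s) \<in> C)"
  (is "_ \<longleftrightarrow> ?down \<and> ?sup")
proof
  assume C: "closedin (scott_topology H) C"
  have ?down using scott_closed_down[OF C] by auto
  moreover have "(m, s) \<in> C" if *: "\<forall>n. (m, n # s) \<in> C" for m s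
  proof (rule scott_closed_lub[OF C])
    let ?A = "range (\<lambda>n. (m, n # s))"
    show "?A \<subseteq> C" using * by blast
    have le: "(m, i # s) \<sqsubseteq>\<^bsub>H\<^esub> (m, max i j # s) \<and> (m, j # s) \<sqsubseteq>\<^bsub>H\<^esub> (m, max i j # s)" for i j
      by (simp add: H_le_Cons_Cons)
    show "directed H ?A"
      unfolding directed_def
    proof (intro conjI ballI)
      fix x y assume "x \<in> ?A" "y \<in> ?A"
      then show "\<exists>z\<in>?A. x \<sqsubseteq>\<^bsub>H\<^esub> z \<and> y \<sqsubseteq>\<^bsub>H\<^esub> z" using le by blast
    qed auto
    show "is_lub H (m, s) ?A"
      by (rule is_lub_H_chain) (auto intro: H_refl)
  qed
  ultimately show "?down \<and> ?sup" by blast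
next
  assume C: "?down \<and> ?sup"
  show "closedin (scott_topology H) C"
    unfolding closedin_scott_iff
  proof (intro conjI allI impI)
    show "\<forall>y\<in>C. \<forall>x\<in>carrier H. x \<sqsubseteq>\<^bsub>H\<^esub> y \<longrightarrow> x \<in> C" using C by blast
    fix A z assume A: "directed H A \<and> is_lub H z A \<and> A \<subseteq> C"
    then have "directed H A" by blast
    then show "z \<in> C"
    proof (cases rule: directed_H_cases)
      case (max x)
      then have "x \<in> Upper H A" by (auto simp: Upper_def)
      then have "z \<sqsubseteq>\<^bsub>H\<^esub> x" using A by (simp add: least_def)
      then show ?thesis using max A C by blast
    next
      case (chain m s)
      then have "is_lub H (m, s) A" using is_lub_H_chain by blast
      then have "z = (m, s)" using A H_antisym by (meson least_def)
      have "(m, k # s) \<in> C" for k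
      proof -
        obtain n where n: "k \<le> n" "(m, n # s) \<in> A" using chain(2) by blast
        then have "(m, k # s) \<sqsubseteq>\<^bsub>H\<^esub> (m, n # s)" by (simp add: H_le_Cons_Cons)
        then show ?thesis using n A C by blast
      qed
      then show ?thesis using C \<open>z = _\<close> by blast
    qed
  qed simp
qed

text \<open>This is where \<open><\<^sub>3\<close> enters: infinitely many points of a level \<open>{(m, s) | m}\<close> already
  generate the whole level.\<close>

lemma level_in_closed:
  assumes C: "closedin (scott_topology H) C" and inf: "\<And>k. \<exists>m\<ge>k. (m, s) \<in> C"
  shows "(a, s) \<in> C"
proof -
  have "(a, n # s) \<in> C" for n
  proof -
    obtain m where "n \<le> m" "(m, s) \<in> C" using inf by blast
    moreover have "(a, n # s) \<sqsubseteq>\<^bsub>H\<^esub> (m, s)"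
      unfolding H_le_iff using \<open>n \<le> m\<close> by (intro exI[of _ "[n]"] exI[of _ s]) auto
    ultimately show ?thesis using C unfolding closedin_H_iff by blast
  qed
  then show ?thesis using C unfolding closedin_H_iff by blast
qed

section \<open>Ideals generated by levels\<close>

definition level_closure :: "nat list \<Rightarrow> (nat \<times> nat list) set" where
  "level_closure s = {x. \<exists>m. x \<sqsubseteq>\<^bsub>H\<^esub> (m, s)}"

text \<open>The bound \<open>(m, s)\<close> may be chosen with \<open>m = a\<close>, which removes
  the condition on the first coordinates.\<close>

lemma level_closure_iff:
  "(a, w) \<in> level_closure s \<longleftrightarrow> (\<exists>t u. w = t @ u \<and> head_le u s)"
  by (auto simp: level_closure_def H_le_iff)

lemma level_closure_subset_iff:
  assumes "closedin (scott_topology H) C"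
  shows "level_closure s \<subseteq> C \<longleftrightarrow> (\<forall>m. (m, s) \<in> C)"
proof
  show "level_closure s \<subseteq> C \<Longrightarrow> \<forall>m. (m, s) \<in> C"
    using H_refl unfolding level_closure_def by blast
  show "\<forall>m. (m, s) \<in> C \<Longrightarrow> level_closure s \<subseteq> C"
    using assms unfolding level_closure_def closedin_H_iff by blast
qed

lemma closedin_level_closure: "closedin (scott_topology H) (level_closure s)"
  unfolding closedin_H_iff
proof (intro conjI allI impI)
  show "x \<in> level_closure s" if "y \<in> level_closure s" "x \<sqsubseteq>\<^bsub>H\<^esub> y" for x y
    using that H_trans unfolding level_closure_def by blast
  fix m w assume *: "\<forall>n. (m, n # w) \<in> level_closure s"
  \<comment> \<open>Larger than every entry of \<open>s\<close>, so \<open>n\<close> cannot be a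
    head below that of \<open>s\<close> and must lie in the removed prefix.\<close>
  define n where "n = Suc (sum_list s)"
  obtain t u where tu: "n # w = t @ u" "head_le u s" using * level_closure_iff by blast
  have "t \<noteq> []"
  proof
    assume "t = []"
    then obtain n' where "n \<le> n'" "s = n' # w" using tu by (auto simp: head_le_Cons)
    then show False by (simp add: n_def)
  qed
  then obtain t' where "w = t' @ u" using tu by (cases t) auto
  then show "(m, w) \<in> level_closure s" using tu level_closure_iff by blast
qed

text \<open>Pigeonhole: one of two covering closed sets contains infinitely many points of the
  level, hence the whole level by \<open>level_in_closed\<close>.\<close>

lemma level_closure_Irr: "level_closure s \<in> carrier (Irr H)"
  unfolding carrier_Irr irreducible_in_def
proof (intro conjI allI impI)
  show "closedin (scott_topology H) (level_closure s)" by (rule closedin_level_closure)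
  show "level_closure s \<subseteq> topspace (scott_topology H)" by (simp add: topspace_scott_topology)
  have mem: "(m, s) \<in> level_closure s" for m using level_closure_iff head_le_refl by blast
  then show "level_closure s \<noteq> {}" by blast
  fix C D
  assume CD: "closedin (scott_topology H) C \<and> closedin (scott_topology H) D \<and>
    level_closure s \<subseteq> C \<union> D"
  show "level_closure s \<subseteq> C \<or> level_closure s \<subseteq> D"
  proof (cases "\<forall>k. \<exists>m\<ge>k. (m, s) \<in> C")
    case True
    then show ?thesis using level_in_closed level_closure_subset_iff CD by metis
  next
    case False
    then obtain k where k: "\<And>m. k \<le> m \<Longrightarrow> (m, s) \<notin> C" by blast
    have "(m, s) \<in> D" if "k \<le> m" for m using k[OF that] mem[of m] CD by blast
    then have "\<exists>m\<ge>j. (m, s) \<in> D" for j by (meson max.cobounded1 max.cobounded2)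
    then show ?thesis using level_in_closed level_closure_subset_iff CD by metis
  qed
qed

section \<open>Classification of the Scott-closed irreducible sets\<close>

text \<open>A nonempty relatively open part of an irreducible set is dense in it; here
  \<open>F \<inter> V\<close> is that part and \<open>C\<close> is a closed set containing
  it.\<close>

lemma irreducible_in_remove:
  assumes "irreducible_in X F" "closedin X (F - V)" "closedin X C" "V \<subseteq> C" "F \<inter> V \<noteq> {}"
  shows "F \<subseteq> C"
proof -
  have "F \<subseteq> (F - V) \<union> C" using assms(4) by blast
  then have "F \<subseteq> F - V \<or> F \<subseteq> C" using assms(1-3) unfolding irreducible_in_def by blast
  then show ?thesis using assms(5) by blast
qed

text \<open>In both cases below, the points removed from \<open>F\<close> are those whose strings extend \<open>s\<close> by
  entries too large for \<open><\<^sub>3\<close> to lead outside the closed set generated by \<open>(m, s)\<close>,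
  respectively by the level of \<open>s\<close>.\<close>

lemma irreducible_subset_down_set:
  assumes F: "closedin (scott_topology H) F" and irr: "irreducible_in (scott_topology H) F"
    and m: "(m, s) \<in> F"
    and shortest: "\<And>a w. (a, w) \<in> F \<Longrightarrow> length s \<le> length w"
    and top: "\<And>w. head_le s w \<Longrightarrow> (m, w) \<in> F \<Longrightarrow> w = s"
    and level: "\<not> level_closure s \<subseteq> F"
  shows "F \<subseteq> down_set H (m, s)"
proof -
  have down: "y \<in> F \<Longrightarrow> x \<sqsubseteq>\<^bsub>H\<^esub> y \<Longrightarrow> x \<in> F" for x y using F unfolding closedin_H_iff by blast
  have sup: "(\<And>n. (a, n # w) \<in> F) \<Longrightarrow> (a, w) \<in> F" for a w using F unfolding closedin_H_iff by blast
  have lower: "(a, u) \<in> F" if "head_le u v" "(a, v) \<in> F" for a u v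
  using down[OF that(2) H_le_head[OF that(1)]] .
  \<comment> \<open>For each suffix \<open>t2\<close>, the dropped entries exceed every first
    coordinate that \<open>F\<close> has on the level of \<open>t2 @ s\<close>, so
    \<open>less3\<close> cannot reach that level inside \<open>F\<close>. Such entries exist because
    the level is not contained in \<open>F\<close>, which by \<open>level_in_closed\<close> bounds
    those coordinates.\<close>
  define good where "good t \<longleftrightarrow> (\<forall>t1 t2. t = t1 @ t2 \<longrightarrow>
    (\<exists>a. (a, t2 @ s) \<notin> F) \<and> (\<forall>n\<in>set t1. \<forall>a. (a, t2 @ s) \<in> F \<longrightarrow> a < n))" for t
  define V where "V = {(m, t @ s) | t. good t}"
  have good_suffix: "good t2" if "good (t1 @ t2)" for t1 t2
    unfolding good_def
  proof (intro allI impI)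
    fix r1 r2 assume "t2 = r1 @ r2"
    then have "t1 @ t2 = (t1 @ r1) @ r2" by simp
    then show "(\<exists>a. (a, r2 @ s) \<notin> F) \<and> (\<forall>n\<in>set r1. \<forall>a. (a, r2 @ s) \<in> F \<longrightarrow> a < n)"
      using that unfolding good_def by (metis UnI2 set_append)
  qed
  have good_Cons: "good (n # t) \<longleftrightarrow> good t \<and> (\<exists>a. (a, n # t @ s) \<notin> F) \<and>
      (\<forall>t1 t2. t = t1 @ t2 \<longrightarrow> (\<forall>a. (a, t2 @ s) \<in> F \<longrightarrow> a < n))" for n t
  proof
    assume g: "good (n # t)"
    have "good t" using good_suffix[of "[n]" t] g by simp
    moreover have "\<exists>a. (a, n # t @ s) \<notin> F"
      using g unfolding good_def by (metis append_Cons append_Nil)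
    moreover have "a < n" if "t = t1 @ t2" "(a, t2 @ s) \<in> F" for t1 t2 a
      using g that unfolding good_def by (metis append_Cons list.set_intros(1))
    ultimately show "good t \<and> (\<exists>a. (a, n # t @ s) \<notin> F) \<and>
      (\<forall>t1 t2. t = t1 @ t2 \<longrightarrow> (\<forall>a. (a, t2 @ s) \<in> F \<longrightarrow> a < n))" by blast
  next
    assume g: "good t \<and> (\<exists>a. (a, n # t @ s) \<notin> F) \<and>
      (\<forall>t1 t2. t = t1 @ t2 \<longrightarrow> (\<forall>a. (a, t2 @ s) \<in> F \<longrightarrow> a < n))"
    show "good (n # t)"
      unfolding good_def
    proof (intro allI impI)
      fix t1 t2 assume eq: "n # t = t1 @ t2"
      show "(\<exists>a. (a, t2 @ s) \<notin> F) \<and> (\<forall>k\<in>set t1. \<forall>a. (a, t2 @ s) \<in> F \<longrightarrow> a < k)"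
      proof (cases t1)
        case Nil
        then show ?thesis using eq g by auto
      next
        case (Cons b r)
        then have "b = n" "t = r @ t2" using eq by auto
        then show ?thesis using g Cons unfolding good_def by auto
      qed
    qed
  qed
  have "good []"
    using level level_closure_subset_iff[OF F] unfolding good_def by auto
  \<comment> \<open>This keeps \<open>F - V\<close> closed under suprema of chains: a chain whose
    supremum is in \<open>V\<close> has a member in \<open>V\<close>.\<close>
  have good_extend: "\<exists>n. good (n # t)" if t: "good t" for t
  proof -
    have bd: "\<exists>b. \<forall>a. (a, u @ s) \<in> F \<longrightarrow> a < b" if "t = r @ u" for r u
    proof (rule ccontr)
      assume "\<nexists>b. \<forall>a. (a, u @ s) \<in> F \<longrightarrow> a < b"
      then have "\<And>k. \<exists>a\<ge>k. (a, u @ s) \<in> F" by (meson not_le)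
      then have "(a, u @ s) \<in> F" for a using level_in_closed[OF F] by blast
      then show False using t that unfolding good_def by blast
    qed
    have "\<exists>b. \<forall>i\<le>length t. \<forall>a. (a, drop i t @ s) \<in> F \<longrightarrow> a < b"
    proof -
      have "\<forall>i. \<exists>b. \<forall>a. (a, drop i t @ s) \<in> F \<longrightarrow> a < b"
        using bd by (metis append_take_drop_id)
      then obtain f where f: "\<And>i a. (a, drop i t @ s) \<in> F \<Longrightarrow> a < f i" by metis
      have "a < Max (f ` {..length t})" if "i \<le> length t" "(a, drop i t @ s) \<in> F" for i a
        using f[OF that(2)] that(1) by (auto intro!: less_le_trans[of a "f i"] Max_ge)
      then show ?thesis by blast
    qed
    then obtain b where b: "\<And>i a. i \<le> length t \<Longrightarrow> (a, drop i t @ s) \<in> F \<Longrightarrow> a < b" by blast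
    \<comment> \<open>As \<open>F\<close> is Scott-closed, a point missing at \<open>t @ s\<close>
      forces one missing at some \<open>n0 # t @ s\<close>, and raising the head keeps it missing.
      The head \<open>max b n0\<close> therefore meets both conditions.\<close>
    obtain a0 where a0: "(a0, t @ s) \<notin> F" using t unfolding good_def by (metis append_Nil)
    then obtain n0 where n0: "(a0, n0 # t @ s) \<notin> F" using sup by blast
    have "head_le (n0 # t @ s) (max b n0 # t @ s)" by (simp add: head_le_Cons)
    then have "(a0, max b n0 # t @ s) \<notin> F" using n0 lower by blast
    moreover have "a < max b n0" if "t = t1 @ t2" "(a, t2 @ s) \<in> F" for t1 t2 a
      using b[of "length t1" a] that by simp
    ultimately have "good (max b n0 # t)" using t good_Cons by blast
    then show ?thesis ..
  qed
  \<comment> \<open>\<open>V\<close> is upward closed within \<open>F\<close>: minimality of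
    \<open>s\<close> keeps the removed prefix \<open>r\<close> inside \<open>t\<close>, goodness
    then excludes a change of the first coordinate, and \<open>top\<close> excludes raising the head
    of \<open>s\<close> itself.\<close>
  have up: "y \<in> V" if "x \<in> V" "x \<sqsubseteq>\<^bsub>H\<^esub> y" "y \<in> F" for x y
  proof -
    obtain t where t: "x = (m, t @ s)" "good t" using \<open>x \<in> V\<close> unfolding V_def by blast
    obtain m' v where y: "y = (m', v)" by fastforce
    obtain r u where ru: "t @ s = r @ u" "head_le u v" "m = m' \<or> (\<exists>n\<in>set r. n \<le> m')"
      using \<open>x \<sqsubseteq>\<^bsub>H\<^esub> y\<close> unfolding t y H_le_iff by blast
    have "length s \<le> length u" using shortest that(3) head_le_length[OF ru(2)] y by simp
    then obtain t2 where t2: "u = t2 @ s" "t = r @ t2"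
      using ru(1) by (auto simp: append_eq_append_conv2)
    have uF: "(m', t2 @ s) \<in> F" using lower ru(2) that(3) y t2 by blast
    have "m' < n" if "n \<in> set r" for n using t(2) t2(2) uF that unfolding good_def by blast
    then have [simp]: "m' = m" using ru(3) by (meson not_le)
    have "good t2" using t(2) t2(2) good_suffix by blast
    show "y \<in> V"
    proof (cases t2)
      case Nil
      then have "v = s" using top ru(2) t2 that(3) y by simp
      then show ?thesis using y \<open>good []\<close> unfolding V_def by force
    next
      case (Cons c t3)
      then obtain c' where c': "c \<le> c'" "v = c' # t3 @ s" using ru(2) t2 by (auto simp: head_le_Cons)
      have g: "good (c # t3)" using \<open>good t2\<close> Cons by simp
      then obtain a where "(a, c # t3 @ s) \<notin> F" using good_Cons by blast
      then have "(a, c' # t3 @ s) \<notin> F" using lower c'(1) head_le_Cons by blast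
      moreover have "b < c'" if "t3 = t1 @ t2" "(b, t2 @ s) \<in> F" for t1 t2 b
        using g c'(1) that unfolding good_Cons by (blast intro: less_le_trans)
      ultimately have "good (c' # t3)" using g unfolding good_Cons by blast
      then show ?thesis using y c' unfolding V_def by force
    qed
  qed
  show ?thesis
  proof (rule irreducible_in_remove[OF irr])
    show "closedin (scott_topology H) (F - V)"
      unfolding closedin_H_iff
    proof (intro conjI allI impI)
      show "x \<in> F - V" if "y \<in> F - V" "x \<sqsubseteq>\<^bsub>H\<^esub> y" for x y
        using that up down by blast
      fix a w assume *: "\<forall>n. (a, n # w) \<in> F - V"
      have "(a, w) \<notin> V"
      proof
        assume "(a, w) \<in> V"
        then obtain t where t: "a = m" "w = t @ s" "good t" unfolding V_def by blast
        then obtain n where "good (n # t)" using good_extend by blast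
        then have "(a, n # w) \<in> V" using t unfolding V_def by force
        then show False using * by blast
      qed
      then show "(a, w) \<in> F - V" using sup * by blast
    qed
    show "closedin (scott_topology H) (down_set H (m, s))"
      using partial_order.closedin_down_set[OF partial_order_H] by simp
    have "(m, t @ s) \<sqsubseteq>\<^bsub>H\<^esub> (m, s)" for t unfolding H_le_iff using head_le_refl by blast
    then show "V \<subseteq> down_set H (m, s)" by (auto simp: V_def down_set_def)
    have "(m, s) \<in> V" using \<open>good []\<close> unfolding V_def by force
    then show "F \<inter> V \<noteq> {}" using m by blast
  qed
qed

lemma irreducible_subset_level_closure:
  assumes F: "closedin (scott_topology H) F" and irr: "irreducible_in (scott_topology H) F"
    and shortest: "\<And>a w. (a, w) \<in> F \<Longrightarrow> length s \<le> length w"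
    and top: "\<And>w. head_le s w \<Longrightarrow> (m, w) \<in> F \<Longrightarrow> w = s"
    and level: "level_closure s \<subseteq> F"
  shows "F \<subseteq> level_closure s"
proof -
  have down: "y \<in> F \<Longrightarrow> x \<sqsubseteq>\<^bsub>H\<^esub> y \<Longrightarrow> x \<in> F" for x y using F unfolding closedin_H_iff by blast
  have sup: "(\<And>n. (a, n # w) \<in> F) \<Longrightarrow> (a, w) \<in> F" for a w using F unfolding closedin_H_iff by blast
  \<comment> \<open>By \<open>top\<close>, the level of \<open>Suc c # s'\<close> is not contained
    in \<open>F\<close>, so its first coordinates in \<open>F\<close> are bounded. Every string
    obtained by strictly raising the head of \<open>s\<close> lies above this one.\<close>
  have "\<exists>k. \<forall>a w. head_le s w \<and> w \<noteq> s \<and> (a, w) \<in> F \<longrightarrow> a < k"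
  proof (cases s)
    case Nil
    then show ?thesis by (auto simp: head_le_def)
  next
    case (Cons c s')
    have "(m, Suc c # s') \<notin> F" using top[of "Suc c # s'"] Cons by (auto simp: head_le_Cons)
    then obtain k where k: "\<And>a. (a, Suc c # s') \<in> F \<Longrightarrow> a < k"
      using level_in_closed[OF F] by (meson not_le)
    have "a < k" if w: "head_le s w" "w \<noteq> s" "(a, w) \<in> F" for a w
    proof -
      obtain c' where c': "Suc c \<le> c'" "w = c' # s'"
        using w Cons by (auto simp: head_le_Cons) (metis le_antisym not_less_eq_eq)
      then have "(a, Suc c # s') \<sqsubseteq>\<^bsub>H\<^esub> (a, w)" by (simp add: H_le_Cons_Cons)
      then show ?thesis using k down w(3) by blast
    qed
    then show ?thesis by blast
  qed
  then obtain k where k: "\<And>a w. head_le s w \<Longrightarrow> w \<noteq> s \<Longrightarrow> (a, w) \<in> F \<Longrightarrow> a < k" by blast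
  \<comment> \<open>One threshold for entries and first coordinates: a \<open>less3\<close> step
    inside \<open>V\<close> passes from an entry at least \<open>k\<close> to a first coordinate at
    least \<open>k\<close>, beyond the reach of points of \<open>F\<close> with a raised
    head.\<close>
  define V where "V = {(a, t @ s) | a t. k \<le> a \<and> (\<forall>n\<in>set t. k \<le> n)}"
  have up: "y \<in> V" if "x \<in> V" "x \<sqsubseteq>\<^bsub>H\<^esub> y" "y \<in> F" for x y
  proof -
    obtain a t where t: "x = (a, t @ s)" "k \<le> a" "\<forall>n\<in>set t. k \<le> n" using \<open>x \<in> V\<close> unfolding V_def by blast
    obtain m' v where y: "y = (m', v)" by fastforce
    obtain r u where ru: "t @ s = r @ u" "head_le u v" "a = m' \<or> (\<exists>n\<in>set r. n \<le> m')"
      using \<open>x \<sqsubseteq>\<^bsub>H\<^esub> y\<close> unfolding t y H_le_iff by blast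
    have "length s \<le> length u" using shortest that(3) head_le_length[OF ru(2)] y by simp
    then obtain t2 where t2: "u = t2 @ s" "t = r @ t2"
      using ru(1) by (auto simp: append_eq_append_conv2)
    have "k \<le> m'" using ru(3) t t2 by (auto intro: order_trans)
    show "y \<in> V"
    proof (cases t2)
      case Nil
      then have "v = s" using k[of v m'] ru(2) t2 that(3) y \<open>k \<le> m'\<close> by auto
      then show ?thesis using y \<open>k \<le> m'\<close> unfolding V_def by force
    next
      case (Cons c t3)
      then obtain c' where c': "c \<le> c'" "v = c' # t3 @ s" using ru(2) t2 by (auto simp: head_le_Cons)
      then have "v = (c' # t3) @ s" "\<forall>n\<in>set (c' # t3). k \<le> n" using t t2 Cons by auto
      then show ?thesis using y \<open>k \<le> m'\<close> unfolding V_def by blast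
    qed
  qed
  show ?thesis
  proof (rule irreducible_in_remove[OF irr])
    show "closedin (scott_topology H) (F - V)"
      unfolding closedin_H_iff
    proof (intro conjI allI impI)
      show "x \<in> F - V" if "y \<in> F - V" "x \<sqsubseteq>\<^bsub>H\<^esub> y" for x y
        using that up down by blast
      fix a w assume *: "\<forall>n. (a, n # w) \<in> F - V"
      have "(a, w) \<notin> V"
      proof
        assume "(a, w) \<in> V"
        then obtain t where "w = t @ s" "k \<le> a" "\<forall>n\<in>set t. k \<le> n" unfolding V_def by blast
        \<comment> \<open>The least admissible entry \<open>k\<close> already yields a member of the
          chain inside \<open>V\<close>.\<close>
        then have "k # w = (k # t) @ s" "k \<le> a" "\<forall>n\<in>set (k # t). k \<le> n" by auto
        then have "(a, k # w) \<in> V" unfolding V_def by blast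
        then show False using * by blast
      qed
      then show "(a, w) \<in> F - V" using sup * by blast
    qed
    show "closedin (scott_topology H) (level_closure s)" by (rule closedin_level_closure)
    show "V \<subseteq> level_closure s" using head_le_refl unfolding V_def by (blast intro: level_closure_iff[THEN iffD2])
    have "(k, s) \<in> V" unfolding V_def by force
    moreover have "(k, s) \<in> F" using level level_closure_subset_iff[OF F] by blast
    ultimately show "F \<inter> V \<noteq> {}" by blast
  qed
qed

text \<open>Take a point of \<open>F\<close> with a shortest string and raise its head as far as
  \<open>F\<close> allows. The heads are bounded, since otherwise closedness would put the still
  shorter string \<open>s'\<close> into \<open>F\<close>. Whether \<open>F\<close> contains the
  whole resulting level decides between the two forms.\<close>

lemma Irr_H_cases:
  assumes "F \<in> carrier (Irr H)"
  obtains x where "F = down_set H x" | s where "F = level_closure s"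
proof -
  have F: "closedin (scott_topology H) F" and irr: "irreducible_in (scott_topology H) F"
    using assms by (simp_all add: carrier_Irr)
  then obtain x0 where "x0 \<in> F" unfolding irreducible_in_def by blast
  then obtain x where x: "x \<in> F" "\<And>y. y \<in> F \<Longrightarrow> length (snd x) \<le> length (snd y)"
    using ex_has_least_nat[of "\<lambda>x. x \<in> F" x0 "\<lambda>x. length (snd x)"] by blast
  obtain m v where v: "x = (m, v)" by fastforce
  have "\<exists>s. head_le v s \<and> (m, s) \<in> F \<and> (\<forall>w. head_le s w \<longrightarrow> (m, w) \<in> F \<longrightarrow> w = s)"
  proof (cases v)
    case Nil
    then show ?thesis using x v by (auto simp: head_le_def)
  next
    case (Cons c s')
    define N where "N = {n. (m, n # s') \<in> F}"
    have "(m, s') \<notin> F" using x(2)[of "(m, s')"] v Cons by auto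
    then obtain b where b: "(m, b # s') \<notin> F" using F unfolding closedin_H_iff by blast
    have "n < b" if "n \<in> N" for n
    proof (rule ccontr)
      assume "\<not> n < b"
      then have "(m, b # s') \<sqsubseteq>\<^bsub>H\<^esub> (m, n # s')" by (simp add: H_le_Cons_Cons)
      then show False using b that F unfolding closedin_H_iff N_def by blast
    qed
    then have fin: "finite N" by (meson finite_nat_iff_bounded lessThan_iff subsetI)
    have c: "c \<in> N" using x v Cons by (simp add: N_def)
    have "(m, Max N # s') \<in> F" using Max_in[OF fin] c by (auto simp: N_def)
    moreover have "n \<le> Max N" if "(m, n # s') \<in> F" for n
      using Max_ge[OF fin] that by (simp add: N_def)
    ultimately show ?thesis
      using Max_ge[OF fin c] Cons
      by (intro exI[of _ "Max N # s'"]) (auto simp: head_le_Cons intro: le_antisym)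
  qed
  then obtain s where s: "head_le v s" "(m, s) \<in> F"
    and top: "\<And>w. head_le s w \<Longrightarrow> (m, w) \<in> F \<Longrightarrow> w = s" by blast
  have shortest: "length s \<le> length w" if "(a, w) \<in> F" for a w
    using x(2)[OF that] v head_le_length[OF s(1)] by simp
  show thesis
  proof (cases "level_closure s \<subseteq> F")
    case True
    have "F \<subseteq> level_closure s"
      by (rule irreducible_subset_level_closure[where m = m, OF F irr _ _ True])
        (use shortest top in blast)+
    then show ?thesis using that(2) True by blast
  next
    case False
    have "down_set H (m, s) \<subseteq> F"
      using partial_order.down_set_subset_iff[OF partial_order_H _ F] s by simp
    moreover have "F \<subseteq> down_set H (m, s)"
      by (rule irreducible_subset_down_set[OF F irr s(2) _ _ False])
        (use shortest top in blast)+
    ultimately show ?thesis using that(1) by blast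
  qed
qed

section \<open>Principal members determine closed families\<close>

lemma principal_determined_H:
  assumes \<C>: "closedin (scott_topology (Irr H)) \<C>" and S: "S \<in> carrier (Irr H)"
    and prin: "\<And>x. x \<in> S \<Longrightarrow> down_set H x \<in> \<C>"
  shows "S \<in> \<C>"
  using S
proof (cases rule: Irr_H_cases)
  case (1 x)
  then have "x \<in> S" by (simp add: down_set_def)
  then show ?thesis using prin 1 by blast
next
  case (2 s)
  have le: "A \<sqsubseteq>\<^bsub>Irr H\<^esub> B \<longleftrightarrow> A \<subseteq> B" for A B by (simp add: Irr_def)
  let ?A = "range (\<lambda>n. level_closure (n # s))"
  have "level_closure (n # s) \<in> \<C>" for n
  proof (rule scott_closed_down[OF \<C>])
    have "(n, s) \<in> S" unfolding 2 level_closure_def using H_refl by blast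
    then show "down_set H (n, s) \<in> \<C>" by (rule prin)
    show "level_closure (n # s) \<in> carrier (Irr H)" by (rule level_closure_Irr)
    \<comment> \<open>The removed prefix \<open>[n]\<close> has minimum \<open>n\<close>, so
      \<open>less3\<close> permits any \<open>a\<close> here.\<close>
    have "(a, n # s) \<sqsubseteq>\<^bsub>H\<^esub> (n, s)" for a
      unfolding H_le_iff by (intro exI[of _ "[n]"] exI[of _ s]) auto
    moreover have "closedin (scott_topology H) (down_set H (n, s))"
      using partial_order.closedin_down_set[OF partial_order_H] by simp
    ultimately show "level_closure (n # s) \<sqsubseteq>\<^bsub>Irr H\<^esub> down_set H (n, s)"
      unfolding le by (simp add: level_closure_subset_iff) (simp add: down_set_def)
  qed
  then have "?A \<subseteq> \<C>" by blast
  have mono: "level_closure (i # s) \<subseteq> level_closure (j # s)" if "i \<le> j" for i j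
  proof -
    have "head_le (i # s) (j # s)" using that by (simp add: head_le_Cons)
    then have "(a, i # s) \<in> level_closure (j # s)" for a
      unfolding level_closure_iff by (metis append_Nil)
    then show ?thesis by (simp add: level_closure_subset_iff closedin_level_closure)
  qed
  have "directed (Irr H) ?A"
    unfolding directed_def
  proof (intro conjI ballI)
    show "?A \<subseteq> carrier (Irr H)" using level_closure_Irr by blast
    fix A B assume "A \<in> ?A" "B \<in> ?A"
    then obtain i j where "A = level_closure (i # s)" "B = level_closure (j # s)" by blast
    then have "A \<subseteq> level_closure (max i j # s)" "B \<subseteq> level_closure (max i j # s)"
      using mono by simp_all
    then show "\<exists>C\<in>?A. A \<sqsubseteq>\<^bsub>Irr H\<^esub> C \<and> B \<sqsubseteq>\<^bsub>Irr H\<^esub> C" unfolding le by blast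
  qed simp
  moreover have "is_lub (Irr H) (level_closure s) ?A"
    unfolding Irr_def is_lub_inclusion_order
  proof (intro conjI ballI impI)
    show "level_closure s \<in> {S. closedin (scott_topology H) S \<and> irreducible_in (scott_topology H) S}"
      using level_closure_Irr[of s] by (simp add: carrier_Irr)
  next
    fix A assume "A \<in> ?A \<inter> {S. closedin (scott_topology H) S \<and> irreducible_in (scott_topology H) S}"
    then obtain n where "A = level_closure (n # s)" by blast
    moreover have "(a, n # s) \<in> level_closure s" for a
      unfolding level_closure_iff by (metis append_Cons append_Nil head_le_refl)
    ultimately show "A \<subseteq> level_closure s"
      by (simp add: level_closure_subset_iff closedin_level_closure)
  next
    fix T
    assume T: "T \<in> {S. closedin (scott_topology H) S \<and> irreducible_in (scott_topology H) S}"
      "\<forall>A\<in>?A \<inter> {S. closedin (scott_topology H) S \<and> irreducible_in (scott_topology H) S}. A \<subseteq> T"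
    have clT: "closedin (scott_topology H) T" using T(1) by blast
    have "level_closure (n # s) \<subseteq> T" for n
      using T(2) level_closure_Irr[of "n # s"] by (simp add: carrier_Irr)
    then have "(a, n # s) \<in> T" for a n by (simp add: level_closure_subset_iff[OF clT])
    \<comment> \<open>For each \<open>a\<close>, the point \<open>(a, s)\<close> is the supremum of
      the chain \<open>(a, n # s)\<close>, which lies in the closed set \<open>T\<close>.\<close>
    then have "(a, s) \<in> T" for a using clT unfolding closedin_H_iff by blast
    then show "level_closure s \<subseteq> T" by (simp add: level_closure_subset_iff[OF clT])
  qed
  ultimately show ?thesis
    using scott_closed_lub[OF \<C>] \<open>?A \<subseteq> \<C>\<close> 2 by blast
qed

theorem theorem4p1:
  shows "dcpo H \<and>
         order_isomorphic (scott_opens H) (scott_opens (Irr H)) \<and>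
         order_isomorphic (scott_closeds H) (scott_closeds (Irr H))"
proof -
  have "order_isomorphic (scott_closeds H) (scott_closeds (Irr H))"
    by (rule partial_order.order_isomorphic_scott_closeds_Irr[OF partial_order_H])
      (rule principal_determined_H)
  then show ?thesis using dcpo_H order_isomorphic_opens_if_closeds by metis
qed

end
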